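(* Let $\varepsilon>0$ be a fixed constant, $\delta=n^{-(1/3+\varepsilon)}$, and $N=O(\log n)$ (with a suitably large constant). Suppose $\tilde z^1,\dots,\tilde z^N$ are $N$ independent traces drawn from $\mathrm{Del}_\delta(x')$ for some unknown string $x'\in\{0,1\}^{n'}$ with $n'\le n$. Then with probability at least $1-1/n^2$ over the randomness of $\tilde z^1,\dots,\tilde z^N$ the following hold: (1) if $x'$ has no desert, then BMA run on $n'$ and any multiset $\{z^1,\dots,z^N\}$ that is $(1/10)$-close to $\{\tilde z^1,\dots,\tilde z^N\}$ returns $w=x'$; (2) if $x'$ has at least one desert, then BMA run on $n'$ and any multiset $\{z^1,\dots,z^N\}$ that is $(1/10)$-close to $\{\tilde z^1,\dots,\tilde z^N\}$ returns a string $w$ that shares the same $(r'+m+1)$-bit prefix with $x'$, where $r'$ is the first location that is deep in a desert in $x'$.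
   Context: Strings are indexed from $0$; $x_{[a:b]}=(x_a,\dots,x_b)$. $\mathrm{Del}_\delta(x)$ is the distribution of the string obtained from $x$ by deleting each bit independently with probability $\delta$ and concatenating the survivors (a trace). Let $C=\lceil 100/\varepsilon\rceil$, $m=n^{1/3}$, $M=2m+1$ (note: defined in terms of $n$, not $n'$). For $s\in\{0,1\}^{\le C}$, a string is an $s$-desert if it is a prefix of $sss\cdots$ of length at least $M$; a desert is an $s$-desert for some such $s$; a location $i$ of $x'$ is deep in a desert if $x'_{[i-m:i+m]}$ is a desert; $x'$ has no desert if no subword is a desert. Two multisets of strings of the same size are $\eta$-close if one can be obtained from the other by substituting at most an $\eta$ fraction of its strings. Algorithm BMA: input a length $n'$ and a multiset $\{z^1,\dots,z^N\}$ of strings of length at most $n'$. Pad each $z^i$ with $0$'s at the end to a string $u^i$ of length $n'$. Set $\mathrm{current}_i(0)=0$. For $t=0,\dots,n'-1$: let $w_t$ be the majority of $u^1_{\mathrm{current}_1(t)},\dots,u^N_{\mathrm{current}_N(t)}$; set $\mathrm{current}_i(t+1)=\mathrm{current}_i(t)+1$ if $u^i_{\mathrm{current}_i(t)}=w_t$, else $\mathrm{current}_i(t+1)=\mathrm{current}_i(t)$. Output $w=(w_0,\dots,w_{n'-1})$. *)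

theory Defs
  imports
    "HOL-Probability.Probability"
    "HOL-Library.Multiset"
    "HOL-Library.Sublist"
begin

text \<open>Bits are booleans (\<open>False\<close> is 0, \<open>True\<close> is 1) and strings are lists of bits.\<close>

type_synonym bits = "bool list"

text \<open>In the mask, \<open>True\<close> marks a deleted position.\<close>

definition Del :: "real \<Rightarrow> bits \<Rightarrow> bits pmf" where
  "Del \<delta> x = map_pmf (\<lambda>ds. map fst (filter (\<lambda>(b, d). \<not> d) (zip x ds)))
     (replicate_pmf (length x) (bernoulli_pmf \<delta>))"

text \<open>Both end points are included.\<close>

definition subword :: "'a list \<Rightarrow> nat \<Rightarrow> nat \<Rightarrow> 'a list" where
  "subword x a b = take (Suc b - a) (drop a x)"

definition s_desert :: "nat \<Rightarrow> 'a list \<Rightarrow> 'a list \<Rightarrow> bool" where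
  "s_desert M s y \<longleftrightarrow> (\<exists>k. prefix y (concat (replicate k s))) \<and> M \<le> length y"

text \<open>
  The minimum length is \<open>M = 2 * m + 1\<close>.  The empty \<open>s\<close> is harmless, since
  only the empty string is a prefix of its repetition and \<open>M > 0\<close>.
\<close>

definition desert :: "nat \<Rightarrow> nat \<Rightarrow> 'a list \<Rightarrow> bool" where
  "desert C m y \<longleftrightarrow> (\<exists>s. length s \<le> C \<and> s_desert (2 * m + 1) s y)"

definition has_desert :: "nat \<Rightarrow> nat \<Rightarrow> 'a list \<Rightarrow> bool" where
  "has_desert C m x \<longleftrightarrow> (\<exists>y. sublist y x \<and> desert C m y)"

definition deep_in_desert :: "nat \<Rightarrow> nat \<Rightarrow> 'a list \<Rightarrow> nat \<Rightarrow> bool" where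
  "deep_in_desert C m x i \<longleftrightarrow>
     m \<le> i \<and> i + m < length x \<and> desert C m (subword x (i - m) (i + m))"

definition first_deep :: "nat \<Rightarrow> nat \<Rightarrow> 'a list \<Rightarrow> nat" where
  "first_deep C m x = (LEAST i. deep_in_desert C m x i)"

definition mset_close :: "real \<Rightarrow> 'a multiset \<Rightarrow> 'a multiset \<Rightarrow> bool" where
  "mset_close \<eta> Z Z' \<longleftrightarrow>
     (\<exists>A B. A \<subseteq># Z' \<and> size B = size A \<and> real (size A) \<le> \<eta> * real (size Z')
            \<and> Z = Z' - A + B)"

text \<open>Ties are resolved in favour of 0.\<close>

definition majority :: "bool list \<Rightarrow> bool" where
  "majority bs \<longleftrightarrow> length bs < 2 * count_list bs True"

definition pad :: "nat \<Rightarrow> bits \<Rightarrow> bits" where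
  "pad n z = z @ replicate (n - length z) False"

definition bma_vote :: "bits list \<Rightarrow> (nat \<Rightarrow> nat) \<Rightarrow> bool" where
  "bma_vote us c = majority (map (\<lambda>i. us ! i ! c i) [0..<length us])"

text \<open>\<open>bma_current us t i\<close> is the position of the pointer into \<open>us ! i\<close> at time \<open>t\<close>.\<close>

primrec bma_current :: "bits list \<Rightarrow> nat \<Rightarrow> nat \<Rightarrow> nat" where
  "bma_current us 0 = (\<lambda>i. 0)"
| "bma_current us (Suc t) = (\<lambda>i.
     let c = bma_current us t
     in if us ! i ! c i = bma_vote us c then c i + 1 else c i)"

text \<open>
  The input multiset is presented by an arbitrary enumeration \<open>zs\<close> of it.
\<close>

definition BMA :: "nat \<Rightarrow> bits list \<Rightarrow> bits" where
  "BMA n zs = (let us = map (pad n) zs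
     in map (\<lambda>t. bma_vote us (bma_current us t)) [0..<n])"

end

theory Submission
  imports Defs "HOL-Real_Asymp.Real_Asymp"
begin

text \<open>
  As long as the output agrees with \<open>x'\<close>, the pointer into one trace evolves independently of the
  other traces, and its lag at time \<open>t\<close> (position in \<open>x'\<close> minus \<open>t\<close>) grows by one for each deleted bit
  skipped and shrinks by one at each mismatch.  If the lag is a constant \<open>k\<close> with \<open>0 < k \<le> C\<close> for \<open>2 * m + 1\<close>
  steps, then these bits of \<open>x'\<close> have period \<open>k\<close> and form a desert; so before the end of the first desert
  every block of this length contains a deletion or a mismatch.  With \<open>B = C div 2\<close> and windows of length
  \<open>W\<close> slightly above \<open>2 * B\<close> blocks, two conclusions follow.  If no window contains more than \<open>B\<close> deletions,
  the lag never exceeds \<open>2 * B\<close>.  If in addition there is no deletion in the window around \<open>t\<close>, the lag is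
  0 at time \<open>t\<close>, and the trace votes correctly.  Since \<open>W * \<delta> = O(n powr - \<epsilon>)\<close> and \<open>B\<close> is about \<open>50 / \<epsilon>\<close>,
  this fails with probability \<open>o(1)\<close>; a union bound over the sets of \<open>3/10\<close> of the traces and over \<open>t\<close>
  then shows that fewer than \<open>3/10\<close> of the traces are wrong at any time, which leaves a majority even after
  \<open>1/10\<close> of them are replaced.
\<close>

section \<open>Periodic strings and deserts\<close>

definition periodic :: "nat \<Rightarrow> 'a list \<Rightarrow> bool" where
  "periodic k y \<longleftrightarrow> (\<forall>i. i + k < length y \<longrightarrow> y ! (i + k) = y ! i)"

lemma periodic_nth_mod:
  assumes "periodic k y" "0 < k" "i < length y"
  shows "y ! i = y ! (i mod k)"
  using assms(3)
proof (induction i rule: less_induct)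
  case (less i)
  show ?case
  proof (cases "i < k")
    case False
    then have "y ! i = y ! (i - k)"
      using assms(1) less.prems by (auto simp: periodic_def dest: spec[of _ "i - k"])
    also have "\<dots> = y ! ((i - k) mod k)"
      using False assms(2) less by simp
    finally show ?thesis
      using False by (simp add: le_mod_geq)
  qed simp
qed

lemma nth_concat_replicate:
  "i < n * length s \<Longrightarrow> concat (replicate n s) ! i = s ! (i mod length s)"
proof (induction n arbitrary: i)
  case (Suc n)
  then show ?case
    by (cases "i < length s") (auto simp: nth_append le_mod_geq)
qed simp

lemma periodic_desert:
  assumes "periodic k y" "0 < k" "k \<le> C" "k \<le> length y" "2 * m + 1 \<le> length y"
  shows "desert C m y"
proof -
  \<comment> \<open>The repeated word is the first period; since \<open>k\<close> is positive,
    \<open>length y\<close> copies of it are long enough.\<close>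
  let ?s = "take k y" and ?n = "length y"
  have len: "length ?s = k" using assms by simp
  have le: "?n \<le> ?n * k" using assms(2) by simp
  have "y = take ?n (concat (replicate ?n ?s))"
  proof (rule nth_equalityI)
    show "length y = length (take ?n (concat (replicate ?n ?s)))"
      using le len by (simp add: length_concat sum_list_replicate)
  next
    fix i assume i: "i < length y"
    have "concat (replicate ?n ?s) ! i = ?s ! (i mod k)"
      using nth_concat_replicate[of i ?n ?s] i le len by (simp add: less_le_trans)
    then show "y ! i = take ?n (concat (replicate ?n ?s)) ! i"
      using i assms(2) periodic_nth_mod[OF assms(1,2) i] by simp
  qed
  then have "prefix y (concat (replicate ?n ?s))"
    by (metis take_is_prefix)
  then show ?thesis
    unfolding desert_def s_desert_def using assms len by (intro exI[of _ ?s]) auto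
qed

lemma desert_prefix:
  assumes "desert C m y" "prefix y' y" "2 * m + 1 \<le> length y'"
  shows "desert C m y'"
  using assms unfolding desert_def s_desert_def by (meson prefix_order.trans)

text \<open>A desert inside the prefix can be cut to its first \<open>2 * m + 1\<close> symbols. The
  midpoint of this piece is deep, hence not before \<open>first_deep\<close>, so the piece ends
  beyond \<open>t\<close>. The bound is inclusive because announcing bit \<open>t\<close> uses only
  the prefix before it; this is the source of the \<open>+ 1\<close> in the final prefix
  length.\<close>

lemma no_desert_before_first_deep:
  assumes "t \<le> first_deep C m x + m"
  shows "\<not> has_desert C m (take t x)"
proof
  assume "has_desert C m (take t x)"
  then obtain y ps ss where y: "desert C m y" "take t x = ps @ y @ ss"
    by (auto simp: has_desert_def sublist_def)
  let ?i = "length ps + m"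
  have len: "2 * m + 1 \<le> length y"
    using y(1) by (auto simp: desert_def s_desert_def)
  have "length (take t x) = length ps + length y + length ss"
    using y(2) by simp
  then have le: "length ps + length y \<le> t" "length ps + length y \<le> length x"
    by auto
  have "take (2 * m + 1) y = take (2 * m + 1) (drop (length ps) (take t x))"
    using y(2) len by simp
  also have "\<dots> = subword x (?i - m) (?i + m)"
    using le len by (simp add: subword_def drop_take mult_2 del: drop_append)
  finally have eq: "take (2 * m + 1) y = subword x (?i - m) (?i + m)" .
  have "desert C m (take (2 * m + 1) y)"
    using desert_prefix[OF y(1) take_is_prefix] len by simp
  then have "deep_in_desert C m x ?i"
    using le len unfolding eq by (simp add: deep_in_desert_def)
  then have "first_deep C m x \<le> ?i"
    unfolding first_deep_def by (rule Least_le)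
  then show False
    using assms le len by simp
qed

lemma has_desert_take:
  "has_desert C m (take t x) \<Longrightarrow> has_desert C m x"
  unfolding has_desert_def by (meson sublist_order.order.trans sublist_take)

section \<open>The pointer into a trace\<close>

definition cnt :: "(nat \<Rightarrow> bool) \<Rightarrow> nat \<Rightarrow> nat \<Rightarrow> nat" where
  "cnt P a b = card {q \<in> {a..<b}. P q}"

lemma cnt_same [simp]: "cnt P a a = 0"
  by (simp add: cnt_def)

lemma cnt_mono: "a' \<le> a \<Longrightarrow> b \<le> b' \<Longrightarrow> cnt P a b \<le> cnt P a' b'"
  unfolding cnt_def by (intro card_mono) auto

lemma cnt_split: "a \<le> b \<Longrightarrow> b \<le> c \<Longrightarrow> cnt P a c = cnt P a b + cnt P b c"
  unfolding cnt_def by (subst card_Un_disjoint [symmetric]) (auto intro!: arg_cong[of _ _ card])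

lemma cnt_Suc: "a \<le> b \<Longrightarrow> cnt P a (Suc b) = cnt P a b + of_bool (P b)"
proof -
  have "{q \<in> {b..<Suc b}. P q} = (if P b then {b} else {})" by auto
  then show "a \<le> b \<Longrightarrow> ?thesis"
    using cnt_split[of a b "Suc b" P] by (simp add: cnt_def)
qed

lemma cnt_all: "(\<And>q. a \<le> q \<Longrightarrow> q < b \<Longrightarrow> P q) \<Longrightarrow> cnt P a b = b - a"
proof -
  assume "\<And>q. a \<le> q \<Longrightarrow> q < b \<Longrightarrow> P q"
  then have "{q \<in> {a..<b}. P q} = {a..<b}" by auto
  then show ?thesis by (simp add: cnt_def)
qed

lemma cnt_0_iff: "cnt P a b = 0 \<longleftrightarrow> (\<forall>q. a \<le> q \<longrightarrow> q < b \<longrightarrow> \<not> P q)"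
  by (auto simp: cnt_def)

text \<open>The position, in the original string, of the bit that the pointer into a trace looks at, when
  the symbols announced so far are those of \<open>X\<close>; \<open>del\<close> is the set of deleted positions.\<close>

definition nxt :: "(nat \<Rightarrow> bool) \<Rightarrow> nat \<Rightarrow> nat" where
  "nxt del q = (LEAST p. q \<le> p \<and> \<not> del p)"

primrec ptr :: "(nat \<Rightarrow> bool) \<Rightarrow> (nat \<Rightarrow> 'a) \<Rightarrow> nat \<Rightarrow> nat" where
  "ptr del X 0 = nxt del 0"
| "ptr del X (Suc s) =
    (if X (ptr del X s) = X s then nxt del (Suc (ptr del X s)) else ptr del X s)"

text \<open>\<open>X\<close> is total because a pointer may run off the string into the padding.
  Positions from \<open>n\<close> on are never deleted, so \<open>nxt\<close> always finds a
  survivor.\<close>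

locale deletion_mask =
  fixes del :: "nat \<Rightarrow> bool" and X :: "nat \<Rightarrow> 'a" and n :: nat
  assumes del_less: "del q \<Longrightarrow> q < n"
begin

abbreviation "dels \<equiv> cnt del"
abbreviation "mism \<equiv> cnt (\<lambda>s. X (ptr del X s) \<noteq> X s)"
abbreviation "pos \<equiv> ptr del X"

lemma nxt_ge: "q \<le> nxt del q" and not_del_nxt: "\<not> del (nxt del q)"
proof -
  have "q \<le> max q n \<and> \<not> del (max q n)"
    using del_less[of "max q n"] by auto
  then have "q \<le> nxt del q \<and> \<not> del (nxt del q)"
    unfolding nxt_def by (rule LeastI)
  then show "q \<le> nxt del q" "\<not> del (nxt del q)" by auto
qed

lemma del_below_nxt: "q \<le> r \<Longrightarrow> r < nxt del q \<Longrightarrow> del r"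
  unfolding nxt_def using not_less_Least by blast

lemma dels_nxt: "dels q (nxt del q) = nxt del q - q"
  by (intro cnt_all del_below_nxt)

lemma not_del_pos: "\<not> del (pos s)"
  by (induction s) (auto simp: not_del_nxt)

text \<open>A pointer in sync compares \<open>X s\<close> with itself, so it advances; it can
  therefore never fall behind the clock, and the lag is a natural number.\<close>

lemma pos_ge: "s \<le> pos s"
proof (induction s)
  case (Suc s)
  then show ?case
    using nxt_ge[of "Suc (pos s)"] by (cases "pos s = s") auto
qed simp

lemma pos_mono: "a \<le> b \<Longrightarrow> pos a \<le> pos b"
proof (induction rule: dec_induct)
  case (step b)
  then show ?case using nxt_ge[of "Suc (pos b)"] by auto
qed simp

text \<open>The lag equals deletions passed minus mismatches so far; the equation is written
  additively to avoid truncated subtraction.\<close>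

lemma pos_balance_0: "pos b + mism 0 b = b + dels 0 (pos b)"
proof (induction b)
  case 0
  then show ?case by (simp add: dels_nxt)
next
  case (Suc b)
  show ?case
  proof (cases "X (pos b) = X b")
    case True
    let ?q = "nxt del (Suc (pos b))"
    have "dels 0 ?q = dels 0 (Suc (pos b)) + dels (Suc (pos b)) ?q"
      by (intro cnt_split nxt_ge) auto
    also have "\<dots> = dels 0 (pos b) + (?q - Suc (pos b))"
      using not_del_pos[of b] by (simp add: cnt_Suc dels_nxt)
    finally show ?thesis
      using Suc True nxt_ge[of "Suc (pos b)"] by (simp add: cnt_Suc)
  qed (use Suc in \<open>simp add: cnt_Suc\<close>)
qed

lemma pos_balance:
  assumes "a \<le> b"
  shows "pos b + mism a b + a = pos a + b + dels (pos a) (pos b)"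
  using pos_balance_0[of a] pos_balance_0[of b] cnt_split[of 0 a b] assms
    cnt_split[of 0 "pos a" "pos b" del] pos_mono[OF assms]
  by (smt (verit) add.assoc add.commute add_left_cancel zero_le)

lemma pos_le_after_sync:
  assumes "z \<le> s" "pos z = z"
  shows "pos s \<le> s + dels z (pos s)"
  using pos_balance[OF assms(1)] assms(2) by simp

text \<open>A longer jump would cross \<open>Suc B\<close> consecutive deleted positions, all within
  one window.\<close>

lemma nxt_le_sparse:
  assumes "\<And>a. dels a (a + W) \<le> B" "B < W"
  shows "nxt del q \<le> q + B"
proof (rule ccontr)
  assume "\<not> nxt del q \<le> q + B"
  then have "dels q (q + Suc B) = Suc B"
    using cnt_all[of q "q + Suc B" del] del_below_nxt[of q] by auto
  then show False
    using assms cnt_mono[of q q "q + Suc B" "q + W" del] by (metis Suc_leI add_le_cancel_left le_refl le_trans not_less_eq_eq)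
qed

end

section \<open>Bounds on the lag in a desert-free prefix\<close>

locale deletion_mask_list = deletion_mask del X n
  for del :: "nat \<Rightarrow> bool" and X :: "nat \<Rightarrow> 'a" and n :: nat +
  fixes x :: "'a list" and C m t :: nat
  assumes len_x: "length x = n" and X_eq: "q < n \<Longrightarrow> X q = x ! q"
    and no_desert: "\<not> has_desert C m (take t x)" and t_le: "t \<le> n" and C_le: "C \<le> 2 * m"
begin

abbreviation "M \<equiv> 2 * m + 1"

text \<open>With neither deletion nor mismatch the lag is frozen at some \<open>k\<close> and every
  comparison succeeds, which makes the block \<open>k\<close>-periodic. \<open>C_le\<close> ensures
  that a full period fits into the block.\<close>

lemma block_progress:
  assumes "s + M \<le> t" "s < pos s" "pos s \<le> s + C"
  shows "1 \<le> dels (pos s) (pos (s + M)) + mism s (s + M)"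
proof (rule ccontr)
  assume "\<not> ?thesis"
  then have z: "dels (pos s) (pos (s + M)) = 0" "mism s (s + M) = 0" by auto
  define k where "k = pos s - s"
  have k: "pos s = s + k" "0 < k" "k \<le> C" using assms by (auto simp: k_def)
  have shift: "X (s + i + k) = X (s + i)" if "i < M" for i
  proof -
    have "mism s (s + i) \<le> mism s (s + M)" "dels (pos s) (pos (s + i)) \<le> dels (pos s) (pos (s + M))"
      using that by (intro cnt_mono pos_mono; simp)+
    then have "pos (s + i) = s + i + k"
      using pos_balance[of s "s + i"] z k by simp
    moreover have "X (pos (s + i)) = X (s + i)"
      using z(2) that unfolding cnt_0_iff by simp
    ultimately show ?thesis by simp
  qed
  let ?y = "take M (drop s (take t x))"
  have len: "length ?y = M" using assms len_x t_le by simp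
  have "periodic k ?y"
    unfolding periodic_def
  proof (intro allI impI)
    fix i assume "i + k < length ?y"
    then have i: "i + k < M" using len by simp
    then have "x ! (s + i + k) = x ! (s + i)"
      using shift[of i] X_eq[of "s + i + k"] X_eq[of "s + i"] assms t_le by simp
    then show "?y ! (i + k) = ?y ! i"
      using i assms len_x t_le by (simp add: add.assoc)
  qed
  then have "desert C m ?y"
    using k C_le len by (intro periodic_desert) auto
  moreover have "sublist ?y (take t x)"
    by (meson sublist_drop sublist_order.order.trans sublist_take)
  ultimately show False
    using no_desert by (auto simp: has_desert_def)
qed

lemma blocks_progress:
  assumes "s + J * M \<le> t"
    and "\<And>j. j < J \<Longrightarrow> s + j * M < pos (s + j * M) \<and> pos (s + j * M) \<le> s + j * M + C"
  shows "J \<le> dels (pos s) (pos (s + J * M)) + mism s (s + J * M)"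
  using assms
proof (induction J)
  case (Suc J)
  let ?a = "s + J * M" and ?b = "s + Suc J * M"
  have ab: "?a \<le> ?b" "?b = ?a + M" by auto
  have "J \<le> dels (pos s) (pos ?a) + mism s ?a"
    using Suc by (intro Suc.IH) (auto intro: le_trans[OF ab(1)])
  moreover have "1 \<le> dels (pos ?a) (pos ?b) + mism ?a ?b"
    unfolding ab(2) using Suc.prems(1) Suc.prems(2)[of J] by (intro block_progress) (auto simp: ab(2))
  moreover have "dels (pos s) (pos ?b) = dels (pos s) (pos ?a) + dels (pos ?a) (pos ?b)"
    using ab(1) by (intro cnt_split pos_mono) auto
  moreover have "mism s ?b = mism s ?a + mism ?a ?b"
    using ab(1) by (intro cnt_split) auto
  ultimately show ?case by linarith
qed simp

text \<open>A deletion counts twice: it raises the lag by one, and it may account for a block that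
  then has no mismatch.\<close>

lemma pos_drop:
  assumes "s + J * M \<le> t"
    and "\<And>j. j < J \<Longrightarrow> s + j * M < pos (s + j * M) \<and> pos (s + j * M) \<le> s + j * M + C"
  shows "pos (s + J * M) + J \<le> pos s + J * M + 2 * dels (pos s) (pos (s + J * M))"
  using blocks_progress[OF assms] pos_balance[of s "s + J * M"] by linarith

context
  fixes W B :: nat
  assumes sparse: "\<And>a. dels a (a + W) \<le> B"
    and W: "2 * B * M + 3 * B + 1 \<le> W" and B: "2 * B \<le> C"
begin

abbreviation "T \<equiv> 2 * B * M"

text \<open>One step adds at most one run of \<open>B\<close> deletions to the previous lag. This
  crude bound places \<open>pos s\<close> inside a window before the sharper bound is known.\<close>

lemma pos_le_jump:
  assumes "\<And>r. r < s \<Longrightarrow> pos r \<le> r + 2 * B"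
  shows "pos s \<le> s + 3 * B"
proof (cases s)
  case 0
  then show ?thesis using nxt_le_sparse[OF sparse, of 0] W by simp
next
  case (Suc r)
  then show ?thesis
    using nxt_le_sparse[OF sparse, of "Suc (pos r)"] W assms[of r] by auto
qed

text \<open>Looking back \<open>2 * B\<close> blocks: either the pointer was in sync at some moment, or every block
  contributed a deletion or a mismatch.\<close>

lemma pos_look_back:
  assumes "s \<le> t" "T \<le> s" "\<And>r. r < s \<Longrightarrow> pos r \<le> r + 2 * B"
    and "dels (s - T) (pos s) \<le> D"
  shows "pos s \<le> s + max D (2 * dels (pos (s - T)) (pos s))"
proof (cases "\<exists>z. s - T \<le> z \<and> z \<le> s \<and> pos z = z")
  case True
  then obtain z where z: "s - T \<le> z" "z \<le> s" "pos z = z" by blast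
  have "dels z (pos s) \<le> dels (s - T) (pos s)"
    using z by (intro cnt_mono) auto
  then show ?thesis
    using pos_le_after_sync[OF z(2,3)] assms(4) by simp
next
  case False
  let ?a = "s - T"
  have s: "?a + (2 * B) * M = s" using assms by simp
  \<comment> \<open>The drop of \<open>2 * B\<close> over the blocks cancels the initial lag of at
    most \<open>2 * B\<close>; only twice the deletions crossed remain.\<close>
  have "pos (?a + (2 * B) * M) + 2 * B
      \<le> pos ?a + (2 * B) * M + 2 * dels (pos ?a) (pos (?a + (2 * B) * M))"
  proof (rule pos_drop)
    fix j assume j: "j < 2 * B"
    then have "j * M < 2 * B * M" by (intro mult_strict_right_mono) auto
    then have "?a + j * M < s" using s by linarith
    then have "pos (?a + j * M) \<le> ?a + j * M + C"
      using assms(3)[of "?a + j * M"] B by simp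
    moreover have "pos (?a + j * M) \<noteq> ?a + j * M"
      using False \<open>?a + j * M < s\<close> by auto
    ultimately show "?a + j * M < pos (?a + j * M) \<and> pos (?a + j * M) \<le> ?a + j * M + C"
      using pos_ge[of "?a + j * M"] by simp
  qed (use s assms in simp)
  moreover have "pos ?a \<le> ?a + 2 * B"
  proof (cases "T = 0")
    case True
    then have "B = 0" by simp
    then show ?thesis using pos_le_jump[OF assms(3)] by simp
  next
    case False
    then have "?a < s" using assms(2) by linarith
    then show ?thesis by (rule assms(3))
  qed
  ultimately show ?thesis unfolding s using s by linarith
qed

text \<open>Strong induction: the crude bound confines the relevant deletions to one window, and
  looking back with \<open>D = B\<close> restores \<open>2 * B\<close>. Before time \<open>T\<close>
  a single window from 0 sees everything.\<close>

lemma pos_le: "s \<le> t \<Longrightarrow> pos s \<le> s + 2 * B"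
proof (induction s rule: less_induct)
  case (less s)
  then have IH: "\<And>r. r < s \<Longrightarrow> pos r \<le> r + 2 * B" by simp
  have jump: "pos s \<le> s + 3 * B" by (rule pos_le_jump[OF IH])
  show ?case
  proof (cases "s < T")
    case True
    have "dels 0 (pos s) \<le> dels 0 (0 + W)"
      using True jump W by (intro cnt_mono) auto
    then show ?thesis
      using sparse[of 0] pos_balance_0[of s] by linarith
  next
    case False
    have "dels (s - T) (pos s) \<le> dels (s - T) (s - T + W)"
      using False jump W by (intro cnt_mono) auto
    then have D: "dels (s - T) (pos s) \<le> B"
      using sparse[of "s - T"] by linarith
    moreover have "dels (pos (s - T)) (pos s) \<le> dels (s - T) (pos s)"
      by (intro cnt_mono pos_ge) auto
    ultimately show ?thesis
      using pos_look_back[OF less.prems _ IH D] False by auto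
  qed
qed

text \<open>The same look-back with \<open>D = 0\<close> forces the lag to vanish.\<close>

lemma pos_sync:
  assumes "dels (t - T) (t - T + W) = 0"
  shows "pos t = t"
proof (cases "t < T")
  case True
  have "dels 0 (pos t) \<le> dels 0 (0 + W)"
    using True pos_le[of t] W by (intro cnt_mono) auto
  then show ?thesis
    using assms True pos_balance_0[of t] pos_ge[of t] by simp
next
  case False
  have "dels (t - T) (pos t) \<le> dels (t - T) (t - T + W)"
    using False pos_le[of t] W by (intro cnt_mono) auto
  then have D: "dels (t - T) (pos t) \<le> 0"
    using assms by simp
  moreover have "dels (pos (t - T)) (pos t) \<le> dels (t - T) (pos t)"
    by (intro cnt_mono pos_ge) auto
  ultimately show ?thesis
    using pos_look_back[OF _ _ _ D] pos_le pos_ge[of t] False by auto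
qed

end

end

section \<open>Traces and votes\<close>

definition trace :: "'a list \<Rightarrow> bool list \<Rightarrow> 'a list" where
  "trace x ds = map fst (filter (\<lambda>(b, d). \<not> d) (zip x ds))"

lemma cnt_cong: "(\<And>q. a \<le> q \<Longrightarrow> q < b \<Longrightarrow> P q = Q q) \<Longrightarrow> cnt P a b = cnt Q a b"
  unfolding cnt_def by (rule arg_cong[of _ _ card]) auto

lemma length_trace:
  "length ds = length x \<Longrightarrow> length (trace x ds) = cnt (\<lambda>q. \<not> ds ! q) 0 (length x)"
  by (auto simp: trace_def length_filter_conv_card cnt_def intro!: arg_cong[of _ _ card])

lemma trace_split:
  assumes "length ds = length x" "p < length x" "\<not> ds ! p"
  shows "trace x ds = trace (take p x) (take p ds) @ x ! p # trace (drop (Suc p) x) (drop (Suc p) ds)"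
proof -
  have "zip x ds = take p (zip x ds) @ zip x ds ! p # drop (Suc p) (zip x ds)"
    using assms by (intro id_take_nth_drop) simp
  then show ?thesis
    using assms unfolding trace_def take_zip drop_zip by simp
qed

text \<open>A surviving position has as many survivors before it as its index in the trace. For
  \<open>p\<close> past the end this index is at least the length of the trace, so a padding 0 is
  read.\<close>

lemma pad_trace_nth:
  fixes x :: bits
  assumes len: "length ds = length x"
    and del: "\<And>q. del q \<longleftrightarrow> q < length x \<and> ds ! q"
    and p: "\<not> del p" "cnt (\<lambda>q. \<not> del q) 0 p < length x"
  shows "pad (length x) (trace x ds) ! cnt (\<lambda>q. \<not> del q) 0 p = (if p < length x then x ! p else False)"
proof (cases "p < length x")
  case True
  have "length (trace (take p x) (take p ds)) = cnt (\<lambda>q. \<not> take p ds ! q) 0 p"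
    using len True by (subst length_trace) auto
  also have "\<dots> = cnt (\<lambda>q. \<not> del q) 0 p"
    using True by (intro cnt_cong) (simp add: del)
  finally have "pad (length x) (trace x ds) ! cnt (\<lambda>q. \<not> del q) 0 p = x ! p"
    using trace_split[OF len True] p(1) del[of p] True
    by (simp add: pad_def nth_append)
  then show ?thesis using True by simp
next
  case False
  have "cnt (\<lambda>q. \<not> del q) 0 p = cnt (\<lambda>q. \<not> del q) 0 (length x) + cnt (\<lambda>q. \<not> del q) (length x) p"
    using False by (intro cnt_split) auto
  also have "cnt (\<lambda>q. \<not> del q) 0 (length x) = cnt (\<lambda>q. \<not> ds ! q) 0 (length x)"
    by (intro cnt_cong) (simp add: del)
  finally have "length (trace x ds) \<le> cnt (\<lambda>q. \<not> del q) 0 p"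
    using length_trace[OF len] by simp
  then show ?thesis
    using False p(2) by (auto simp: pad_def nth_append)
qed

text \<open>The pointer of BMA into \<open>u\<close>, provided that the output so far agrees with \<open>x\<close>.\<close>

primrec follow :: "'a list \<Rightarrow> 'a list \<Rightarrow> nat \<Rightarrow> nat" where
  "follow x u 0 = 0"
| "follow x u (Suc s) = (if u ! follow x u s = x ! s then follow x u s + 1 else follow x u s)"

text \<open>\<open>nxt\<close> skips only deleted positions, so advancing \<open>pos\<close> moves
  the index in the trace by exactly one. The bound by \<open>s\<close> is carried along to keep this
  index below \<open>n\<close> in \<open>u\<close>.\<close>

lemma (in deletion_mask) follow_eq:
  assumes len: "length x = n" and X: "\<And>q. q < n \<Longrightarrow> X q = x ! q"
    and u: "\<And>p. \<not> del p \<Longrightarrow> cnt (\<lambda>q. \<not> del q) 0 p < n \<Longrightarrow> u ! cnt (\<lambda>q. \<not> del q) 0 p = X p"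
    and "s \<le> n"
  shows "follow x u s = cnt (\<lambda>q. \<not> del q) 0 (pos s) \<and> follow x u s \<le> s"
  using \<open>s \<le> n\<close>
proof (induction s)
  case 0
  show ?case
    using del_below_nxt[of 0] by (simp add: cnt_0_iff)
next
  case (Suc s)
  let ?c = "cnt (\<lambda>q. \<not> del q)"
  have IH: "follow x u s = ?c 0 (pos s)" "follow x u s \<le> s" using Suc by auto
  then have nth: "u ! follow x u s = X (pos s)"
    using u[OF not_del_pos] Suc.prems by simp
  show ?case
  proof (cases "X (pos s) = X s")
    case True
    let ?q = "nxt del (Suc (pos s))"
    have "?c 0 ?q = ?c 0 (Suc (pos s)) + ?c (Suc (pos s)) ?q"
      by (intro cnt_split nxt_ge) auto
    also have "?c (Suc (pos s)) ?q = 0"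
      using del_below_nxt by (simp add: cnt_0_iff)
    finally show ?thesis
      using True IH nth Suc.prems X[of s] not_del_pos[of s] by (simp add: cnt_Suc)
  next
    case False
    then show ?thesis using IH nth Suc.prems X[of s] by simp
  qed
qed

lemma follow_sync:
  fixes x :: bits
  assumes len: "length ds = length x"
    and del: "\<And>q. del q \<longleftrightarrow> q < length x \<and> ds ! q"
    and no_desert: "\<not> has_desert C m (take t x)" and t: "t < length x"
    and B: "2 * B \<le> C" "C \<le> 2 * m" and W: "2 * B * (2 * m + 1) + 3 * B + 1 \<le> W"
    and sparse: "\<And>a. cnt del a (a + W) \<le> B"
    and free: "cnt del (t - 2 * B * (2 * m + 1)) (t - 2 * B * (2 * m + 1) + W) = 0"
  shows "(let u = pad (length x) (trace x ds) in u ! follow x u t = x ! t)"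
proof -
  \<comment> \<open>The value \<open>False\<close> past the end matches the padding.\<close>
  define X where "X q = (if q < length x then x ! q else False)" for q
  interpret deletion_mask_list del X "length x" x C m t
    by unfold_locales (use assms in \<open>auto simp: X_def\<close>)
  let ?u = "pad (length x) (trace x ds)"
  have u: "?u ! cnt (\<lambda>q. \<not> del q) 0 p = X p"
    if "\<not> del p" "cnt (\<lambda>q. \<not> del q) 0 p < length x" for p
    using pad_trace_nth[OF len del that] by (simp add: X_def)
  have "pos t = t"
    using pos_sync[OF sparse W B(1) free] .
  moreover have "follow x ?u t = cnt (\<lambda>q. \<not> del q) 0 (pos t) \<and> follow x ?u t \<le> t"
    using t by (intro follow_eq u) (auto simp: X_def)
  moreover have "\<not> del t"
    using not_del_pos[of t] \<open>pos t = t\<close> by simp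
  ultimately show ?thesis
    using u[of t] t by (simp add: X_def)
qed

text \<open>Uses \<open>follow\<close>, driven by the true string and not by the votes: the event
  concerns one trace alone, so distinct traces misread independently.\<close>

definition misread :: "bits \<Rightarrow> nat \<Rightarrow> bits \<Rightarrow> bool" where
  "misread x t z \<longleftrightarrow> (let u = pad (length x) z in u ! follow x u t \<noteq> x ! t)"

section \<open>From few misreads to a correct output\<close>

lemma count_list_map_nth:
  "count_list (map f [0..<n]) y = card {i. i < n \<and> f i = y}"
proof -
  have "count_list (map f [0..<n]) y = length (filter (\<lambda>z. y = z) (map f [0..<n]))"
    by (simp add: count_list_eq_length_filter)
  also have "\<dots> = card {i. i < n \<and> f i = y}"
    by (auto simp: length_filter_conv_card intro!: arg_cong[of _ _ card])
  finally show ?thesis .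
qed

text \<open>The correct bit has a strict majority, so the tie rule never decides.\<close>

lemma bma_vote_correct:
  assumes cur: "\<And>i. i < length zs \<Longrightarrow> c i = follow x (pad (length x) (zs ! i)) t"
    and few: "2 * size (filter_mset (misread x t) (mset zs)) < length zs"
  shows "bma_vote (map (pad (length x)) zs) c = x ! t"
proof -
  let ?n = "length zs" and ?f = "\<lambda>i. map (pad (length x)) zs ! i ! c i"
  have "size (filter_mset (misread x t) (mset zs)) = length (filter (misread x t) zs)"
    by (metis mset_filter size_mset)
  also have "\<dots> = card {i. i < ?n \<and> ?f i \<noteq> x ! t}"
    unfolding length_filter_conv_card using cur
    by (intro arg_cong[of _ _ card]) (auto simp: misread_def Let_def)
  finally have bad: "2 * card {i. i < ?n \<and> ?f i \<noteq> x ! t} < ?n"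
    using few by simp
  have "{..<?n} = {i. i < ?n \<and> ?f i = x ! t} \<union> {i. i < ?n \<and> ?f i \<noteq> x ! t}"
    by auto
  then have "card {..<?n} = card {i. i < ?n \<and> ?f i = x ! t} + card {i. i < ?n \<and> ?f i \<noteq> x ! t}"
    by (simp only:) (intro card_Un_disjoint, auto)
  moreover have "bma_vote (map (pad (length x)) zs) c
      \<longleftrightarrow> ?n < 2 * card {i. i < ?n \<and> ?f i = True}"
    unfolding bma_vote_def majority_def length_map length_upt diff_zero
    by (subst count_list_map_nth) simp
  ultimately show ?thesis
    using bad by (cases "x ! t") auto
qed

text \<open>Induction on time: correct votes so far keep the true pointers equal to
  \<open>follow\<close>, and then \<open>few\<close> makes the next vote correct.\<close>

lemma BMA_correct:
  assumes few: "\<And>s. s < t \<Longrightarrow> 2 * size (filter_mset (misread x s) (mset zs)) < length zs"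
    and t: "t \<le> length x"
  shows "take t (BMA (length x) zs) = take t x"
proof -
  let ?us = "map (pad (length x)) zs"
  have cur: "\<forall>i<length zs. bma_current ?us s i = follow x (?us ! i) s" if "s \<le> t" for s
    using that
  proof (induction s)
    case (Suc s)
    then have IH: "\<forall>i<length zs. bma_current ?us s i = follow x (?us ! i) s" by simp
    then have "bma_vote ?us (bma_current ?us s) = x ! s"
      using Suc.prems few by (intro bma_vote_correct) auto
    then show ?case using IH by (simp add: Let_def)
  qed simp
  have "bma_vote ?us (bma_current ?us s) = x ! s" if "s < t" for s
    using cur[of s] that few by (intro bma_vote_correct) auto
  then show ?thesis
    using t by (intro nth_equalityI) (auto simp: BMA_def Let_def)
qed

lemma size_filter_mset_close:
  assumes "mset_close \<eta> Z Z'"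
  shows "real (size (filter_mset P Z)) \<le> real (size (filter_mset P Z')) + \<eta> * real (size Z')"
    and "size Z = size Z'"
proof -
  obtain A B where AB: "A \<subseteq># Z'" "size B = size A" "real (size A) \<le> \<eta> * real (size Z')"
    "Z = Z' - A + B"
    using assms by (auto simp: mset_close_def)
  have "size (filter_mset P Z) \<le> size (filter_mset P (Z' - A)) + size B"
    using AB(4) by (simp add: size_filter_mset_lesseq)
  also have "size (filter_mset P (Z' - A)) \<le> size (filter_mset P Z')"
    by (intro size_mset_mono multiset_filter_mono diff_subset_eq_self)
  finally show "real (size (filter_mset P Z)) \<le> real (size (filter_mset P Z')) + \<eta> * real (size Z')"
    using AB(2,3) by linarith
  show "size Z = size Z'"
    using AB(2) size_mset_mono[OF AB(1)] unfolding AB(4) size_union size_Diff_submset[OF AB(1)] by simp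
qed

text \<open>Less than \<open>3/10\<close> misreads plus at most \<open>1/10\<close> substitutes
  stays below one half. No randomness is involved, so the substitutes may depend on the
  traces.\<close>

lemma BMA_correct_close:
  assumes close: "mset_close (1/10) (mset zs) (mset zt)"
    and few: "\<And>s. s < t \<Longrightarrow> 10 * size (filter_mset (misread x s) (mset zt)) < 3 * length zt"
    and t: "t \<le> length x"
  shows "take t (BMA (length x) zs) = take t x"
proof (rule BMA_correct[OF _ t])
  fix s assume "s < t"
  then show "2 * size (filter_mset (misread x s) (mset zs)) < length zs"
    using size_filter_mset_close(1)[OF close, of "misread x s"] size_filter_mset_close(2)[OF close] few[of s] by simp
qed

section \<open>Probability bounds\<close>

text \<open>Independence of coordinates, by splitting off the first one; \<open>A'\<close> is the
  rest of \<open>A\<close> shifted down by one.\<close>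

lemma prob_replicate_pmf_all:
  fixes p :: "'a::countable pmf"
  assumes "A \<subseteq> {..<n}"
  shows "measure_pmf.prob (replicate_pmf n p) {xs. \<forall>i\<in>A. P (xs ! i)}
      = measure_pmf.prob p {x. P x} ^ card A"
  using assms
proof (induction n arbitrary: A)
  case (Suc n)
  define A' where "A' = {i. Suc i \<in> A}"
  have A': "A' \<subseteq> {..<n}" "finite A" using Suc.prems finite_subset by (auto simp: A'_def)
  have A: "A - {0} = Suc ` A'"
    using not0_implies_Suc by (fastforce simp: A'_def image_iff)
  then have "card (A - {0}) = card A'"
    by (simp add: card_image)
  then have card_A: "card A = of_bool (0 \<in> A) + card A'"
    using card_Suc_Diff1[OF A'(2), of 0] by (cases "0 \<in> A") auto
  have "measure_pmf.prob (replicate_pmf (Suc n) p) {xs. \<forall>i\<in>A. P (xs ! i)}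
      = measure_pmf.prob (pair_pmf p (replicate_pmf n p))
          {(x, xs). \<forall>i\<in>A. P ((x # xs) ! i)}"
  proof -
    have "replicate_pmf (Suc n) p = map_pmf (\<lambda>(x, xs). x # xs) (pair_pmf p (replicate_pmf n p))"
      by (simp add: pair_pmf_def map_pmf_def bind_assoc_pmf bind_return_pmf)
    then show ?thesis by (simp add: vimage_def case_prod_beta')
  qed
  also have "{(x, xs). \<forall>i\<in>A. P ((x # xs) ! i)}
      = {x. 0 \<in> A \<longrightarrow> P x} \<times> {xs. \<forall>i\<in>A'. P (xs ! i)}"
    by (auto simp: A'_def nth_Cons split: nat.splits)
  also have "measure_pmf.prob (pair_pmf p (replicate_pmf n p)) \<dots>
      = measure_pmf.prob p {x. 0 \<in> A \<longrightarrow> P x} * measure_pmf.prob p {x. P x} ^ card A'"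
    using Suc.IH[OF A'(1)] by (subst measure_pmf_prob_product) simp_all
  finally show ?case by (simp add: card_A)
qed simp

text \<open>Union bound over the \<open>k\<close>-element subsets of \<open>A\<close>.\<close>

lemma prob_replicate_pmf_card_ge:
  fixes p :: "'a::countable pmf"
  assumes "A \<subseteq> {..<n}" and q: "measure_pmf.prob p {x. P x} \<le> q"
  shows "measure_pmf.prob (replicate_pmf n p) {xs. k \<le> card {i \<in> A. P (xs ! i)}}
      \<le> real (card A choose k) * q ^ k"
proof -
  have fin: "finite A" using assms(1) finite_subset by blast
  let ?S = "{S. S \<subseteq> A \<and> card S = k}"
  have finS: "finite ?S" using fin by simp
  have "{xs. k \<le> card {i \<in> A. P (xs ! i)}} \<subseteq> (\<Union>S\<in>?S. {xs. \<forall>i\<in>S. P (xs ! i)})"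
  proof
    fix xs assume "xs \<in> {xs. k \<le> card {i \<in> A. P (xs ! i)}}"
    then obtain S where "S \<subseteq> {i \<in> A. P (xs ! i)}" "card S = k"
      by (auto elim: obtain_subset_with_card_n)
    then show "xs \<in> (\<Union>S\<in>?S. {xs. \<forall>i\<in>S. P (xs ! i)})"
      by (intro UN_I[of S]) auto
  qed
  then have "measure_pmf.prob (replicate_pmf n p) {xs. k \<le> card {i \<in> A. P (xs ! i)}}
      \<le> measure_pmf.prob (replicate_pmf n p) (\<Union>S\<in>?S. {xs. \<forall>i\<in>S. P (xs ! i)})"
    by (intro measure_pmf.finite_measure_mono) auto
  also have "\<dots> \<le> (\<Sum>S\<in>?S. measure_pmf.prob (replicate_pmf n p) {xs. \<forall>i\<in>S. P (xs ! i)})"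
    using finS by (intro measure_pmf.finite_measure_subadditive_finite) auto
  also have "\<dots> = (\<Sum>S\<in>?S. measure_pmf.prob p {x. P x} ^ k)"
  proof (rule sum.cong)
    fix S assume "S \<in> ?S"
    then show "measure_pmf.prob (replicate_pmf n p) {xs. \<forall>i\<in>S. P (xs ! i)}
        = measure_pmf.prob p {x. P x} ^ k"
      using assms(1) by (subst prob_replicate_pmf_all) auto
  qed simp
  also have "\<dots> \<le> (\<Sum>S\<in>?S. q ^ k)"
    using q by (intro sum_mono power_mono) auto
  also have "\<dots> = real (card A choose k) * q ^ k"
    using n_subsets[OF fin] by simp
  finally show ?thesis .
qed

text \<open>Cruder form for deletions in a window; the votes use the binomial form.\<close>

lemma prob_replicate_pmf_card_ge_power:
  fixes p :: "'a::countable pmf"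
  assumes "A \<subseteq> {..<n}" "card A \<le> W" and q: "measure_pmf.prob p {x. P x} \<le> q"
  shows "measure_pmf.prob (replicate_pmf n p) {xs. k \<le> card {i \<in> A. P (xs ! i)}}
      \<le> (real W * q) ^ k"
proof -
  have q0: "0 \<le> q" using q measure_nonneg order_trans by blast
  have "real (card A choose k) \<le> real W ^ k"
  proof (cases "k \<le> card A")
    case True
    then have "(card A choose k) \<le> card A ^ k" by (rule binomial_le_pow)
    also have "\<dots> \<le> W ^ k" using assms(2) by (rule power_mono) simp
    finally show ?thesis by (metis of_nat_le_iff of_nat_power)
  qed (simp add: binomial_eq_0)
  then have "real (card A choose k) * q ^ k \<le> real W ^ k * q ^ k"
    using q0 by (intro mult_right_mono) auto
  then show ?thesis
    using prob_replicate_pmf_card_ge[OF assms(1) q, of k] by (simp add: power_mult_distrib)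
qed

section \<open>Choice of parameters and failure probabilities\<close>

lemma parameters_eventually:
  fixes \<epsilon> :: real
  assumes "\<epsilon> > 0"
  defines "C \<equiv> nat \<lceil>100 / \<epsilon>\<rceil>"
  defines "B \<equiv> C div 2"
  shows "\<forall>\<^sub>F n in sequentially. 
    (let \<delta> = real n powr (- (1/3 + \<epsilon>)); m = nat \<lceil>real n powr (1/3)\<rceil>;
         W = 2 * B * (2 * m + 1) + 3 * B + 1
     in C \<le> 2 * m \<and> real n * (real W * \<delta>) ^ Suc B + real W * \<delta> \<le> exp (- 20))"
proof -
  \<comment> \<open>Chosen so that \<open>W \<le> A * r\<close> with
    \<open>r = n powr (1/3)\<close>: \<open>8 * B\<close> comes from \<open>m \<le> 2 * r\<close>,
    \<open>5 * B\<close> from the lower-order terms.\<close>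
  define A where "A = 13 * real B + 1"
  define F where "F n = A ^ Suc B * real n powr (1 - \<epsilon> * Suc B) + A * real n powr (- \<epsilon>)" for n
  have "100 / \<epsilon> \<le> real C" unfolding C_def by linarith
  then have "100 \<le> \<epsilon> * real C" using assms(1) by (simp add: field_simps)
  moreover have "C \<le> 2 * Suc B" unfolding B_def by presburger
  then have "\<epsilon> * real C \<le> \<epsilon> * real (2 * Suc B)"
    using assms(1) by (intro mult_left_mono of_nat_mono) auto
  moreover have "\<epsilon> * real (2 * Suc B) = 2 * (\<epsilon> * Suc B)" by simp
  \<comment> \<open>In fact \<open>\<epsilon> * Suc B \<ge> 50\<close>, so the union bound over
    \<open>n\<close> windows is affordable.\<close>
  ultimately have "1 - \<epsilon> * Suc B < 0" by linarith
  then have "F \<longlonglongrightarrow> A ^ Suc B * 0 + A * 0"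
    unfolding F_def using assms(1)
    by (intro tendsto_intros tendsto_neg_powr filterlim_real_sequentially) auto
  then have "F \<longlonglongrightarrow> 0" by simp
  then have "\<forall>\<^sub>F n in sequentially. F n < exp (- 20)"
    by (rule order_tendstoD) simp
  moreover have "filterlim (\<lambda>n. real n powr (1/3)) at_top sequentially"
    by real_asymp
  then have "\<forall>\<^sub>F n in sequentially. real C \<le> real n powr (1/3)"
    by (simp add: filterlim_at_top)
  moreover have "\<forall>\<^sub>F n in sequentially. (1::nat) \<le> n" by (rule eventually_ge_at_top)
  ultimately show ?thesis
  proof eventually_elim
    case (elim n)
    define r where "r = real n powr (1/3)"
    define \<delta> where "\<delta> = real n powr (- (1/3 + \<epsilon>))"
    define m where "m = nat \<lceil>r\<rceil>"
    define W where "W = 2 * B * (2 * m + 1) + 3 * B + 1"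
    have r: "1 \<le> r" using elim(3) by (simp add: r_def ge_one_powr_ge_zero)
    have m: "r \<le> real m" "real m \<le> 2 * r"
      using r unfolding m_def by linarith+
    have "real W = real B * (4 * real m) + 5 * real B + 1"
      by (simp add: W_def algebra_simps)
    also have "\<dots> \<le> real B * (8 * r) + 5 * real B * r + 1 * r"
      using m r by (intro add_mono mult_left_mono) (auto simp: mult_le_cancel_left1)
    also have "\<dots> = A * r" by (simp add: A_def algebra_simps)
    finally have "real W * \<delta> \<le> A * r * \<delta>"
      by (rule mult_right_mono) (simp add: \<delta>_def)
    also have "r * \<delta> = real n powr (- \<epsilon>)"
      by (simp add: r_def \<delta>_def powr_add [symmetric])
    then have "A * r * \<delta> = A * real n powr (- \<epsilon>)" by simp
    finally have Wd: "real W * \<delta> \<le> A * real n powr (- \<epsilon>)" .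
    then have "(real W * \<delta>) ^ Suc B \<le> (A * real n powr (- \<epsilon>)) ^ Suc B"
      by (rule power_mono) (simp add: \<delta>_def)
    also have "\<dots> = A ^ Suc B * real n powr (- \<epsilon> * Suc B)"
      using elim(3) by (subst power_mult_distrib, subst powr_realpow [symmetric], simp, subst powr_powr, simp)
    finally have "real n * (real W * \<delta>) ^ Suc B \<le> real n * (A ^ Suc B * real n powr (- \<epsilon> * Suc B))"
      by (rule mult_left_mono) simp
    also have "\<dots> = A ^ Suc B * (real n powr 1 * real n powr (- \<epsilon> * Suc B))"
      using elim(3) by simp
    also have "\<dots> = A ^ Suc B * real n powr (1 - \<epsilon> * Suc B)"
      by (subst powr_add [symmetric]) simp
    finally have "real n * (real W * \<delta>) ^ Suc B + real W * \<delta> \<le> exp (- 20)"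
      using Wd elim(1) unfolding F_def by linarith
    moreover have "C \<le> 2 * m" using elim(2) m unfolding r_def by linarith
    ultimately show ?case
      unfolding Let_def \<delta>_def m_def W_def r_def by blast
  qed
qed

text \<open>By \<open>follow_sync\<close>, a misread requires more than \<open>B\<close> deletions
  in one of \<open>length x\<close> windows, or a deletion in the window around \<open>t\<close>;
  these give the two summands.\<close>

lemma prob_misread:
  assumes \<delta>: "0 \<le> \<delta>" "\<delta> \<le> 1"
    and no_desert: "\<not> has_desert C m (take t x)" and t: "t < length x"
    and B: "2 * B \<le> C" "C \<le> 2 * m" and W: "2 * B * (2 * m + 1) + 3 * B + 1 \<le> W"
  shows "measure_pmf.prob (Del \<delta> x) {z. misread x t z}
      \<le> real (length x) * (real W * \<delta>) ^ Suc B + real W * \<delta>"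
proof -
  let ?n = "length x" and ?p = "replicate_pmf (length x) (bernoulli_pmf \<delta>)"
  define window where "window a = {a..<min (a + W) ?n}" for a
  define many where "many k a = {ds. k \<le> card {i \<in> window a. ds ! i}}" for k a
  let ?t0 = "t - 2 * B * (2 * m + 1)"
  \<comment> \<open>Intersecting with the support fixes the length of the mask.\<close>
  have sub: "{ds. misread x t (trace x ds)} \<inter> set_pmf ?p
      \<subseteq> (\<Union>a<?n. many (Suc B) a) \<union> many 1 ?t0"
  proof (rule subsetI, rule ccontr)
    fix ds
    assume ds: "ds \<in> {ds. misread x t (trace x ds)} \<inter> set_pmf ?p"
      and not: "ds \<notin> (\<Union>a<?n. many (Suc B) a) \<union> many 1 ?t0"
    define del where "del q \<longleftrightarrow> q < ?n \<and> ds ! q" for q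
    have len: "length ds = ?n" using ds by (auto simp: set_replicate_pmf)
    have cnt: "cnt del a (a + W) = card {i \<in> window a. ds ! i}" for a
      unfolding cnt_def window_def del_def by (rule arg_cong[of _ _ card]) auto
    have sparse: "cnt del a (a + W) \<le> B" for a
    proof (cases "a < ?n")
      case True
      then have "ds \<notin> many (Suc B) a" using not by blast
      then show ?thesis by (simp add: cnt many_def)
    next
      case False
      then have "cnt del a (a + W) = 0" by (auto simp: cnt_0_iff del_def)
      then show ?thesis by simp
    qed
    have free: "cnt del ?t0 (?t0 + W) = 0"
      using not unfolding cnt many_def by simp
    show False
      using follow_sync[OF len del_def no_desert t B W sparse free] ds
      by (simp add: misread_def Let_def)
  qed
  have window: "window a \<subseteq> {..<?n}" "card (window a) \<le> W" for a
    by (auto simp: window_def)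
  have "{b. b} = {True}" by auto
  then have "measure_pmf.prob (bernoulli_pmf \<delta>) {b. b} \<le> \<delta>"
    using \<delta> measure_pmf_single[of "bernoulli_pmf \<delta>" True] by simp
  then have many: "measure_pmf.prob ?p (many k a) \<le> (real W * \<delta>) ^ k" for k a
    unfolding many_def using window by (intro prob_replicate_pmf_card_ge_power)
  have "measure_pmf.prob (Del \<delta> x) {z. misread x t z}
      = measure_pmf.prob ?p {ds. misread x t (trace x ds)}"
    by (simp add: Del_def trace_def vimage_def)
  also have "\<dots> = measure_pmf.prob ?p ({ds. misread x t (trace x ds)} \<inter> set_pmf ?p)"
    by (simp add: measure_Int_set_pmf)
  also have "\<dots> \<le> measure_pmf.prob ?p ((\<Union>a<?n. many (Suc B) a) \<union> many 1 ?t0)"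
    using sub by (intro measure_pmf.finite_measure_mono) auto
  also have "\<dots> \<le> measure_pmf.prob ?p (\<Union>a<?n. many (Suc B) a) + measure_pmf.prob ?p (many 1 ?t0)"
    by (intro measure_Un_le) auto
  also have "measure_pmf.prob ?p (\<Union>a<?n. many (Suc B) a)
      \<le> (\<Sum>a<?n. measure_pmf.prob ?p (many (Suc B) a))"
    by (intro measure_pmf.finite_measure_subadditive_finite) auto
  also have "\<dots> \<le> (\<Sum>a<?n. (real W * \<delta>) ^ Suc B)"
    by (intro sum_mono many)
  finally show ?thesis
    using many[of 1 ?t0] by simp
qed

text \<open>There are at most \<open>2 ^ N\<close> sets of \<open>k \<ge> 3 * N / 10\<close> traces,
  each entirely misread with probability at most \<open>exp (- 20 * k)\<close>. Hence one time costs
  at most \<open>exp (N - 6 * N)\<close>, which pays for up to \<open>n\<close> times.\<close>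

lemma prob_fails_le:
  fixes p :: "'a::countable pmf"
  assumes "finite I" "real (card I) \<le> real n" "1 \<le> n" "ln (real n) \<le> real N"
    and "\<And>t. t \<in> I \<Longrightarrow> measure_pmf.prob p {z. P t z} \<le> exp (- 20)"
  shows "measure_pmf.prob (replicate_pmf N p)
      (\<Union>t\<in>I. {zs. 3 * N \<le> 10 * card {i \<in> {..<N}. P t (zs ! i)}}) \<le> 1 / (real n)\<^sup>2"
proof -
  define k where "k = nat \<lceil>3 * real N / 10\<rceil>"
  have k: "3 * real N / 10 \<le> real k" unfolding k_def by linarith
  have ge: "3 * N \<le> 10 * j \<longleftrightarrow> k \<le> j" for j unfolding k_def by linarith
  have single: "measure_pmf.prob (replicate_pmf N p) {zs. 3 * N \<le> 10 * card {i \<in> {..<N}. P t (zs ! i)}}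
      \<le> exp (- 5 * real N)" if "t \<in> I" for t
  proof -
    have "measure_pmf.prob (replicate_pmf N p) {zs. k \<le> card {i \<in> {..<N}. P t (zs ! i)}}
        \<le> real (card {..<N} choose k) * exp (- 20) ^ k"
      using assms(5)[OF that] by (intro prob_replicate_pmf_card_ge) auto
    also have "\<dots> \<le> exp 1 ^ N * exp (- 20) ^ k"
    proof (rule mult_right_mono)
      have "(N choose k) \<le> 2 ^ N"
        by (rule binomial_le_pow2)
      then have "real (N choose k) \<le> 2 ^ N" by (metis of_nat_le_iff of_nat_numeral of_nat_power)
      also have "\<dots> \<le> exp 1 ^ N"
        using exp_ge_add_one_self[of 1] by (intro power_mono) auto
      finally show "real (card {..<N} choose k) \<le> exp 1 ^ N" by simp
    qed simp
    also have "\<dots> = exp (real N - 20 * real k)"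
      by (simp add: exp_of_nat_mult [symmetric] exp_add [symmetric] mult.commute)
    also have "\<dots> \<le> exp (- 5 * real N)" using k by simp
    finally show ?thesis by (simp add: ge)
  qed
  have "measure_pmf.prob (replicate_pmf N p)
      (\<Union>t\<in>I. {zs. 3 * N \<le> 10 * card {i \<in> {..<N}. P t (zs ! i)}})
      \<le> (\<Sum>t\<in>I. measure_pmf.prob (replicate_pmf N p)
          {zs. 3 * N \<le> 10 * card {i \<in> {..<N}. P t (zs ! i)}})"
    using assms(1) by (intro measure_pmf.finite_measure_subadditive_finite) auto
  also have "\<dots> \<le> (\<Sum>t\<in>I. exp (- 5 * real N))"
    by (intro sum_mono single)
  also have "\<dots> \<le> real n * exp (- 5 * real N)"
    using assms(2) by (simp add: mult_right_mono)
  \<comment> \<open>Exponent 3 is enough: one factor \<open>n\<close> goes to the union bound,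
    leaving the square.\<close>
  also have "\<dots> \<le> real n * exp (- 3 * ln (real n))"
  proof -
    have "0 \<le> ln (real n)" using assms(3) by simp
    then show ?thesis using assms(4) by (intro mult_left_mono) auto
  qed
  also have "exp (- 3 * ln (real n)) = 1 / real n ^ 3"
  proof -
    have "exp (3 * ln (real n)) = real n ^ 3"
      using assms(3) exp_of_nat_mult[of 3 "ln (real n)"] by simp
    then show ?thesis by (simp add: exp_minus inverse_eq_divide)
  qed
  also have "real n * (1 / real n ^ 3) = 1 / (real n)\<^sup>2"
    using assms(3) by (simp add: power2_eq_square power3_eq_cube)
  finally show ?thesis .
qed

lemma size_filter_mset_conv_card:
  "size (filter_mset P (mset xs)) = card {i \<in> {..<length xs}. P (xs ! i)}"
proof -
  have "size (filter_mset P (mset xs)) = length (filter P xs)"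
    by (metis mset_filter size_mset)
  then show ?thesis by (simp add: length_filter_conv_card)
qed

theorem theorem5:
  fixes \<epsilon> :: real
  assumes "\<epsilon> > 0"
  shows "\<exists>K0>0. \<forall>K\<ge>K0. \<exists>n0::nat. \<forall>n\<ge>n0. \<forall>x' :: bits. length x' \<le> n \<longrightarrow>
    (let \<delta> = real n powr (- (1/3 + \<epsilon>));
         N = nat \<lceil>K * ln (real n)\<rceil>;
         C = nat \<lceil>100 / \<epsilon>\<rceil>;
         m = nat \<lceil>real n powr (1/3)\<rceil>;
         n' = length x'
     in measure_pmf.prob (replicate_pmf N (Del \<delta> x'))
          {zt. (\<not> has_desert C m x' \<longrightarrow>
                  (\<forall>zs. (\<forall>z\<in>set zs. length z \<le> n') \<and> mset_close (1/10) (mset zs) (mset zt)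
                     \<longrightarrow> BMA n' zs = x'))
             \<and> (has_desert C m x' \<longrightarrow>
                  (\<forall>zs. (\<forall>z\<in>set zs. length z \<le> n') \<and> mset_close (1/10) (mset zs) (mset zt)
                     \<longrightarrow> take (first_deep C m x' + m + 1) (BMA n' zs)
                         = take (first_deep C m x' + m + 1) x'))}
        \<ge> 1 - 1 / (real n)\<^sup>2)"
proof -
  define C where "C = nat \<lceil>100 / \<epsilon>\<rceil>"
  define B where "B = C div 2"
  obtain n1 where n1: "\<And>n. n \<ge> n1 \<Longrightarrow>
    (let \<delta> = real n powr (- (1/3 + \<epsilon>)); m = nat \<lceil>real n powr (1/3)\<rceil>;
         W = 2 * B * (2 * m + 1) + 3 * B + 1
     in C \<le> 2 * m \<and> real n * (real W * \<delta>) ^ Suc B + real W * \<delta> \<le> exp (- 20))"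
    using parameters_eventually[OF assms] unfolding eventually_sequentially C_def B_def by blast
  have main: "1 - 1 / (real n)\<^sup>2 \<le> measure_pmf.prob (replicate_pmf N (Del \<delta> x))
      {zt. (\<not> has_desert C m x \<longrightarrow>
              (\<forall>zs. (\<forall>z\<in>set zs. length z \<le> length x) \<and> mset_close (1/10) (mset zs) (mset zt)
                 \<longrightarrow> BMA (length x) zs = x))
         \<and> (has_desert C m x \<longrightarrow>
              (\<forall>zs. (\<forall>z\<in>set zs. length z \<le> length x) \<and> mset_close (1/10) (mset zs) (mset zt)
                 \<longrightarrow> take (first_deep C m x + m + 1) (BMA (length x) zs)
                     = take (first_deep C m x + m + 1) x))}"
    (is "_ \<le> measure_pmf.prob ?p ?good")
    if n: "1 \<le> n" "n1 \<le> n" and len: "length x \<le> n" and N: "ln (real n) \<le> real N"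
      and \<delta>: "\<delta> = real n powr (- (1/3 + \<epsilon>))" and m: "m = nat \<lceil>real n powr (1/3)\<rceil>"
    for n N m :: nat and x :: bits and \<delta>
  proof -
    define W where "W = 2 * B * (2 * m + 1) + 3 * B + 1"
    have par: "C \<le> 2 * m" "real n * (real W * \<delta>) ^ Suc B + real W * \<delta> \<le> exp (- 20)"
      using n1[OF n(2)] by (simp_all add: Let_def \<delta> m W_def)
    have \<delta>01: "0 \<le> \<delta>" "\<delta> \<le> 1"
      using powr_mono[of "- (1/3 + \<epsilon>)" 0 "real n"] n(1) assms by (simp_all add: \<delta>)
    \<comment> \<open>These times cover both claims: all positions if there is no desert, and
      otherwise those up to \<open>first_deep C m x + m\<close>.\<close>
    define I where "I = {t. t < length x \<and> \<not> has_desert C m (take t x)}"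
    define fail where
      "fail = (\<Union>t\<in>I. {zt. 3 * N \<le> 10 * card {i \<in> {..<N}. misread x t (zt ! i)}})"
    have finI: "finite I" unfolding I_def by simp
    have "card I \<le> card {..<length x}" unfolding I_def by (intro card_mono) auto
    then have cardI: "real (card I) \<le> real n" using len by simp
    have misread: "measure_pmf.prob (Del \<delta> x) {z. misread x t z} \<le> exp (- 20)" if "t \<in> I" for t
    proof -
      have "measure_pmf.prob (Del \<delta> x) {z. misread x t z}
          \<le> real (length x) * (real W * \<delta>) ^ Suc B + real W * \<delta>"
        using that by (intro prob_misread[OF \<delta>01 _ _ _ par(1)]) (auto simp: I_def B_def W_def)
      also have "real (length x) * (real W * \<delta>) ^ Suc B \<le> real n * (real W * \<delta>) ^ Suc B"
        using len \<delta>01 by (intro mult_right_mono) auto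
      finally show ?thesis using par(2) by linarith
    qed
    have "set_pmf ?p - fail \<subseteq> ?good"
    proof
      fix zt assume zt: "zt \<in> set_pmf ?p - fail"
      then have lenN: "length zt = N" by (simp add: set_replicate_pmf)
      have few: "10 * size (filter_mset (misread x t) (mset zt)) < 3 * length zt" if "t \<in> I" for t
        using zt that lenN unfolding fail_def size_filter_mset_conv_card by force
      have ok: "take t (BMA (length x) zs) = take t x"
        if "mset_close (1/10) (mset zs) (mset zt)" "t \<le> length x" "\<And>s. s < t \<Longrightarrow> \<not> has_desert C m (take s x)"
        for t zs
        using that by (intro BMA_correct_close[OF that(1)] few) (auto simp: I_def)
      have len_BMA: "length (BMA (length x) zs) = length x" for zs
        by (simp add: BMA_def Let_def)
      show "zt \<in> ?good"
      proof (intro CollectI conjI impI allI; elim conjE)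
        fix zs assume "\<not> has_desert C m x" and close: "mset_close (1/10) (mset zs) (mset zt)"
        then show "BMA (length x) zs = x"
          using ok[OF close, of "length x"] has_desert_take[of C m _ x] len_BMA[of zs] by auto
      next
        fix zs assume close: "mset_close (1/10) (mset zs) (mset zt)"
        let ?t = "first_deep C m x + m + 1"
        \<comment> \<open>Each \<open>s < ?t\<close> satisfies
          \<open>s \<le> first_deep C m x + m\<close>. The \<open>min\<close> caps the prefix at the
          whole string.\<close>
        have "take (min ?t (length x)) (BMA (length x) zs) = take (min ?t (length x)) x"
          by (intro ok[OF close] no_desert_before_first_deep) auto
        then show "take ?t (BMA (length x) zs) = take ?t x"
          using len_BMA[of zs] by (cases "?t \<le> length x") (auto simp: min_def)
      qed
    qed
    then have "measure_pmf.prob ?p ((UNIV - fail) \<inter> set_pmf ?p) \<le> measure_pmf.prob ?p ?good"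
      by (intro measure_pmf.finite_measure_mono) auto
    then have "measure_pmf.prob ?p (UNIV - fail) \<le> measure_pmf.prob ?p ?good"
      by (simp add: measure_Int_set_pmf)
    moreover have "measure_pmf.prob ?p (UNIV - fail) = 1 - measure_pmf.prob ?p fail"
      using measure_pmf.prob_compl[of fail ?p] by simp
    moreover have "measure_pmf.prob ?p fail \<le> 1 / (real n)\<^sup>2"
      unfolding fail_def by (rule prob_fails_le[OF finI cardI n(1) N misread])
    ultimately show ?thesis by linarith
  qed
  show ?thesis
  \<comment> \<open>Any \<open>K \<ge> 1\<close> gives \<open>ln n \<le> N\<close>, as
    \<open>prob_fails_le\<close> demands; the threshold \<open>max 1 n1\<close> is the same for all
    \<open>K\<close>.\<close>
  proof (rule exI[of _ 1], intro conjI allI impI)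
    fix K :: real assume K: "1 \<le> K"
    have N: "ln (real n) \<le> real (nat \<lceil>K * ln (real n)\<rceil>)" if "1 \<le> n" for n :: nat
    proof -
      have "1 * ln (real n) \<le> K * ln (real n)"
        using K that by (intro mult_right_mono) auto
      then show ?thesis by linarith
    qed
    show "\<exists>n0::nat. \<forall>n\<ge>n0. \<forall>x' :: bits. length x' \<le> n \<longrightarrow>
    (let \<delta> = real n powr (- (1/3 + \<epsilon>));
         N = nat \<lceil>K * ln (real n)\<rceil>;
         C = nat \<lceil>100 / \<epsilon>\<rceil>;
         m = nat \<lceil>real n powr (1/3)\<rceil>;
         n' = length x'
     in measure_pmf.prob (replicate_pmf N (Del \<delta> x'))
          {zt. (\<not> has_desert C m x' \<longrightarrow>
                  (\<forall>zs. (\<forall>z\<in>set zs. length z \<le> n') \<and> mset_close (1/10) (mset zs) (mset zt)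
                     \<longrightarrow> BMA n' zs = x'))
             \<and> (has_desert C m x' \<longrightarrow>
                  (\<forall>zs. (\<forall>z\<in>set zs. length z \<le> n') \<and> mset_close (1/10) (mset zs) (mset zt)
                     \<longrightarrow> take (first_deep C m x' + m + 1) (BMA n' zs)
                         = take (first_deep C m x' + m + 1) x'))}
        \<ge> 1 - 1 / (real n)\<^sup>2)"
      unfolding Let_def C_def [symmetric]
      by (intro exI[of _ "max 1 n1"] allI impI main N) auto
  qed simp
qed

end
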